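(* Let $1\le p<\infty$, let $n$ be a positive integer, consider the $n$-normed space $(\ell^p,\|\cdot,\dots,\cdot\|_p)$ with a fixed linearly independent set $Y=\{y_1,\dots,y_n\}\subset\ell^p$, and let $K\subseteq\ell^p$ be nonempty, closed and bounded. If $T:K\to K$ is a contractive mapping with respect to the norms of class-$m$ collection for some $m\in\{1,\dots,n\}$, then $T$ has a unique fixed point.
   Context: $\ell^p$ is the real vector space of real sequences $x=(x_j)$ with $\sum_j|x_j|^p<\infty$. It is equipped with the $n$-norm $$\|x_1,\dots,x_n\|_p=\left[\frac1{n!}\sum_{j_1}\cdots\sum_{j_n}\left|\det[\xi_{ij_k}]_{i,k}\right|^p\right]^{1/p},\qquad x_i=(\xi_{ij})_j\in\ell^p,\ i=1,\dots,n.$$ Fix a linearly independent set $Y=\{y_1,\dots,y_n\}\subset X:=\ell^p$. For $m\in\{1,\dots,n\}$ and an $m$-element subset $\{i_1,\dots,i_m\}\subset\{1,\dots,n\}$, let $Y^0_{i_1,\dots,i_m}=\mathrm{span}\{y_i: i\notin\{i_1,\dots,i_m\}\}$, let $X^*_{i_1,\dots,i_m}=X/Y^0_{i_1,\dots,i_m}$, let $\overline{u}$ denote the coset of $u\in X$, and define the norm $$\|\overline{u}\|^*_{i_1,\dots,i_m}=\sum_{j=1}^m\|u,y_1,\dots,y_{i_j-1},y_{i_j+1},\dots,y_n\|_p$$ on $X^*_{i_1,\dots,i_m}$. The set of these $\binom{n}{m}$ quotient spaces is the class-$m$ collection, and their norms are "the norms of class-$m$ collection". A sequence $\{x_k\}$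 in $X$ converges to $x\in X$ (with respect to the norms of class-$m$ collection) if for every $\epsilon>0$ there is $N\in\mathbb{N}$ such that $\|\overline{x_k-x}\|^*_{i_1,\dots,i_m}<\epsilon$ for all $k\ge N$ and every $m$-element subset $\{i_1,\dots,i_m\}\subset\{1,\dots,n\}$. A set $K\subseteq X$ is closed if the limit of any sequence in $K$ that converges in $X$ belongs to $K$. A nonempty $K$ is bounded if there is $M>0$ such that $\|\overline{x}\|^*_{i_1,\dots,i_m}\le M$ for every $x\in K$ and every such subset. (These notions are independent of the choice of $m$; here they may be taken with respect to the norms of class-$m$ collection.) A mapping $T:K\to K$ is contractive with respect to the norms of class-$m$ collection if there is $C\in(0,1)$ such that for all $x,y\in K$, $\|\overline{Tx-Ty}\|^*_{i_1,\dots,i_m}\le C\,\|\overline{x-y}\|^*_{i_1,\dots,i_m}$ for every $m$-element subset $\{i_1,\dots,i_m\}\subset\{1,\dots,n\}$. *)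

theory Defs
  imports
    "HOL-Analysis.Analysis"
    "HOL-Library.Function_Algebras"
    "Jordan_Normal_Form.Determinant"
begin

text \<open>
  Sequences are functions \<open>nat \<Rightarrow> real\<close>. The pointwise real vector space structure makes
  the library's \<open>span\<close> and \<open>independent\<close> available for them.
\<close>

instantiation "fun" :: (type, real_vector) real_vector
begin

definition scaleR_fun :: "real \<Rightarrow> ('a \<Rightarrow> 'b) \<Rightarrow> 'a \<Rightarrow> 'b"
  where "scaleR_fun c f = (\<lambda>x. c *\<^sub>R f x)"

instance
  by standard
    (simp_all add: scaleR_fun_def fun_eq_iff scaleR_add_right scaleR_add_left)

end

definition ell :: "real \<Rightarrow> (nat \<Rightarrow> real) set"
  where "ell p = {x. summable (\<lambda>j. \<bar>x j\<bar> powr p)}"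

text \<open>
  An \<open>n\<close>-tuple of sequences is a list of length \<open>n\<close>, and so is a tuple
  \<open>(j\<^sub>1, \<dots>, j\<^sub>n)\<close> of column indices. The iterated sum over \<open>j\<^sub>1, \<dots>, j\<^sub>n\<close> has nonnegative
  terms and is written as one unordered sum over all index tuples.
\<close>

definition minor :: "(nat \<Rightarrow> real) list \<Rightarrow> nat list \<Rightarrow> real"
  where "minor xs js = Determinant.det
    (Matrix.mat (length xs) (length xs) (\<lambda>(i, k). (xs ! i) (js ! k)))"

definition n_norm :: "real \<Rightarrow> (nat \<Rightarrow> real) list \<Rightarrow> real"
  where "n_norm p xs =
    (1 / fact (length xs) *
      (\<Sum>\<^sub>\<infinity>js\<in>{js. length js = length xs}. \<bar>minor xs js\<bar> powr p)) powr (1 / p)"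

definition omit :: "nat \<Rightarrow> 'a list \<Rightarrow> 'a list"
  where "omit i ys = take i ys @ drop (Suc i) ys"

text \<open>
  The members of \<open>Y\<close> are indexed from \<open>0\<close>, so \<open>{i\<^sub>1, \<dots>, i\<^sub>m}\<close> becomes a set
  \<open>I \<subseteq> {..<length ys}\<close> with \<open>card I = m\<close>.
\<close>

definition Y0 :: "(nat \<Rightarrow> real) list \<Rightarrow> nat set \<Rightarrow> (nat \<Rightarrow> real) set"
  where "Y0 ys I = span {ys ! i | i. i < length ys \<and> i \<notin> I}"

definition coset :: "(nat \<Rightarrow> real) list \<Rightarrow> nat set \<Rightarrow> (nat \<Rightarrow> real) \<Rightarrow> (nat \<Rightarrow> real) set"
  where "coset ys I u = {u + v | v. v \<in> Y0 ys I}"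

text \<open>
  The norm of a coset is the common value of the defining sum over all representatives;
  \<open>quotient_norm_coset\<close> below shows that it does not depend on the representative.
\<close>

definition quotient_norm :: "real \<Rightarrow> (nat \<Rightarrow> real) list \<Rightarrow> nat set \<Rightarrow> (nat \<Rightarrow> real) set \<Rightarrow> real"
  where "quotient_norm p ys I U =
    (THE r. \<exists>u\<in>U. r = (\<Sum>i\<in>I. n_norm p (u # omit i ys)))"

definition index_sets :: "nat \<Rightarrow> nat \<Rightarrow> nat set set"
  where "index_sets n m = {I. I \<subseteq> {..<n} \<and> card I = m}"

definition class_tendsto ::
    "real \<Rightarrow> (nat \<Rightarrow> real) list \<Rightarrow> nat \<Rightarrow> (nat \<Rightarrow> nat \<Rightarrow> real) \<Rightarrow> (nat \<Rightarrow> real) \<Rightarrow> bool"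
  where "class_tendsto p ys m x l \<longleftrightarrow>
    (\<forall>\<epsilon>>0. \<exists>N. \<forall>k\<ge>N. \<forall>I\<in>index_sets (length ys) m.
      quotient_norm p ys I (coset ys I (x k - l)) < \<epsilon>)"

definition class_closed :: "real \<Rightarrow> (nat \<Rightarrow> real) list \<Rightarrow> nat \<Rightarrow> (nat \<Rightarrow> real) set \<Rightarrow> bool"
  where "class_closed p ys m K \<longleftrightarrow>
    (\<forall>x l. (\<forall>k. x k \<in> K) \<and> l \<in> ell p \<and> class_tendsto p ys m x l \<longrightarrow> l \<in> K)"

definition class_bounded :: "real \<Rightarrow> (nat \<Rightarrow> real) list \<Rightarrow> nat \<Rightarrow> (nat \<Rightarrow> real) set \<Rightarrow> bool"
  where "class_bounded p ys m K \<longleftrightarrow>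
    (\<exists>M>0. \<forall>x\<in>K. \<forall>I\<in>index_sets (length ys) m.
      quotient_norm p ys I (coset ys I x) \<le> M)"

definition class_contractive ::
    "real \<Rightarrow> (nat \<Rightarrow> real) list \<Rightarrow> nat \<Rightarrow> (nat \<Rightarrow> real) set
      \<Rightarrow> ((nat \<Rightarrow> real) \<Rightarrow> nat \<Rightarrow> real) \<Rightarrow> bool"
  where "class_contractive p ys m K T \<longleftrightarrow>
    (\<exists>C. 0 < C \<and> C < 1 \<and> (\<forall>x\<in>K. \<forall>y\<in>K. \<forall>I\<in>index_sets (length ys) m.
      quotient_norm p ys I (coset ys I (T x - T y))
        \<le> C * quotient_norm p ys I (coset ys I (x - y))))"

lemma minor_Cons_expand:
  "\<exists>c. \<forall>u. minor (u # xs) js = (\<Sum>k<Suc (length xs). u (js ! k) * c k)"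
proof -
  let ?n = "Suc (length xs)"
  let ?A = "\<lambda>u. Matrix.mat ?n ?n (\<lambda>(i, k). ((u # xs) ! i) (js ! k))"
  have del: "mat_delete (?A u) 0 k = mat_delete (?A 0) 0 k" for u k
    by (rule eq_matI) (auto simp: mat_delete_def)
  have cof: "cofactor (?A u) 0 k = cofactor (?A 0) 0 k" for u k
    unfolding cofactor_def del[of u k] ..
  have "minor (u # xs) js = (\<Sum>k<?n. u (js ! k) * cofactor (?A 0) 0 k)" for u
  proof -
    have "minor (u # xs) js = (\<Sum>k<?n. ?A u $$ (0, k) * cofactor (?A u) 0 k)"
      unfolding minor_def length_Cons by (rule laplace_expansion_row) auto
    also have "\<dots> = (\<Sum>k<?n. u (js ! k) * cofactor (?A 0) 0 k)"
      by (rule sum.cong[OF refl], subst cof) simp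
    finally show ?thesis .
  qed
  then show ?thesis by blast
qed

lemma minor_Cons_add: "minor ((u + v) # xs) js = minor (u # xs) js + minor (v # xs) js"
proof -
  obtain c where "\<forall>u. minor (u # xs) js = (\<Sum>k<Suc (length xs). u (js ! k) * c k)"
    using minor_Cons_expand[of xs js] by (rule exE)
  then show ?thesis by (simp only: plus_fun_apply distrib_right sum.distrib)
qed

lemma minor_Cons_scale: "minor ((c *\<^sub>R u) # xs) js = c * minor (u # xs) js"
proof -
  obtain d where "\<forall>u. minor (u # xs) js = (\<Sum>k<Suc (length xs). u (js ! k) * d k)"
    using minor_Cons_expand[of xs js] by (rule exE)
  then show ?thesis
    by (simp only: scaleR_fun_def real_scaleR_def sum_distrib_left mult.assoc)
qed

lemma minor_Cons_mem:
  assumes "u \<in> set xs"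
  shows "minor (u # xs) js = 0"
proof -
  obtain k where k: "k < length xs" "xs ! k = u"
    using assms by (auto simp: in_set_conv_nth)
  show ?thesis
    unfolding minor_def
    by (rule det_identical_rows[where i = 0 and j = "Suc k" and n = "Suc (length xs)"])
      (use k in \<open>auto intro!: eq_vecI\<close>)
qed

lemma minor_Cons_span:
  assumes "v \<in> span (set xs)"
  shows "minor (v # xs) js = 0"
  using assms
proof (induction rule: span_induct_alt)
  case base
  show ?case using minor_Cons_scale[of 0 0 xs js] by (simp only: scaleR_zero_left mult_zero_left)
next
  case (step c x y)
  then show ?case
    by (simp only: minor_Cons_add minor_Cons_scale minor_Cons_mem mult_zero_right add_0_left)
qed

lemma quotient_norm_coset:
  "quotient_norm p ys I (coset ys I u) = (\<Sum>i\<in>I. n_norm p (u # omit i ys))"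
proof -
  have eq: "n_norm p ((u + v) # omit i ys) = n_norm p (u # omit i ys)"
    if v: "v \<in> Y0 ys I" and i: "i \<in> I" for v i
  proof -
    have "{ys ! k | k. k < length ys \<and> k \<notin> I} \<subseteq> set (omit i ys)"
    proof
      fix z assume "z \<in> {ys ! k | k. k < length ys \<and> k \<notin> I}"
      then obtain k where k: "k < length ys" "k \<notin> I" "z = ys ! k" by blast
      then have "k < i \<or> Suc i \<le> k" using i by (metis Suc_leI linorder_neqE_nat)
      then show "z \<in> set (omit i ys)"
      proof
        assume "k < i"
        then have "take i ys ! k = z" "k < length (take i ys)" using k by auto
        then show ?thesis unfolding omit_def by (metis Un_iff nth_mem set_append)
      next
        assume "Suc i \<le> k"
        then have "drop (Suc i) ys ! (k - Suc i) = z" "k - Suc i < length (drop (Suc i) ys)"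
          using k by auto
        then show ?thesis unfolding omit_def by (metis Un_iff nth_mem set_append)
      qed
    qed
    then have "v \<in> span (set (omit i ys))"
      using v span_mono unfolding Y0_def by blast
    then show ?thesis by (simp add: n_norm_def minor_Cons_add minor_Cons_span)
  qed
  have "0 \<in> Y0 ys I" by (simp add: Y0_def span_zero)
  then have "u \<in> coset ys I u" by (force simp: coset_def)
  moreover have "(\<Sum>i\<in>I. n_norm p (w # omit i ys)) = (\<Sum>i\<in>I. n_norm p (u # omit i ys))"
    if "w \<in> coset ys I u" for w
    using that eq by (auto simp: coset_def intro!: sum.cong)
  ultimately show ?thesis
    unfolding quotient_norm_def by (intro the_equality) blast+
qed

end

theory Submission
  imports Defs
begin

text \<open>
  The sum \<open>q\<close> of all norms of the class is equivalent to the usual norm of \<open>\<ell>\<^sup>p\<close>,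
  and the contraction condition is inherited by \<open>q\<close>, so Banach's argument applies. The upper
  bound of \<open>q\<close> comes from expanding the minors along their first row. For the lower
  bound, fix columns \<open>js\<close> in which the minor \<open>D\<close> of \<open>Y\<close> does not vanish and expand
  the minor \<open>W(j)\<close> of \<open>u, y\<^sub>1, \<dots>, y\<^sub>n\<close> in the columns \<open>j, js\<close> in two ways. Along column
  \<open>j\<close> it is \<open>D u(j)\<close> plus a combination of the \<open>y\<^sub>i(j)\<close> whose coefficients are minors of
  \<open>u\<close> and \<open>Y\<close> without \<open>y\<^sub>i\<close>; along the row of \<open>y\<^sub>1\<close> it is a combination of minors of \<open>u\<close>
  and \<open>Y\<close> without \<open>y\<^sub>1\<close>. Hence \<open>u\<close> is controlled by the class norms.

  Only the quasi-triangle inequality for \<open>p\<close>-th powers is needed: since \<open>K\<close> is bounded,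
  \<open>q(T\<^sup>k a - T\<^sup>k b) \<le> C\<^sup>k B\<close> for all \<open>a, b\<close> in \<open>K\<close>, which makes the Picard
  iterates a Cauchy sequence without summing a geometric series.
\<close>

section \<open>Bounds on sums of \<open>p\<close>-th powers\<close>

text \<open>Bounding all finite partial sums expresses summability and a bound on the sum at once;
  the value 0 that \<open>infsum\<close> takes on a divergent family can then never pass for an
  estimate.\<close>

definition psum_le :: "real \<Rightarrow> 'a set \<Rightarrow> ('a \<Rightarrow> real) \<Rightarrow> real \<Rightarrow> bool"
  where "psum_le p A f B \<longleftrightarrow> (\<forall>F. finite F \<longrightarrow> F \<subseteq> A \<longrightarrow> (\<Sum>a\<in>F. \<bar>f a\<bar> powr p) \<le> B)"

lemma psum_leD: "psum_le p A f B \<Longrightarrow> finite F \<Longrightarrow> F \<subseteq> A \<Longrightarrow> (\<Sum>a\<in>F. \<bar>f a\<bar> powr p) \<le> B"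
  by (simp add: psum_le_def)

lemma psum_le_nonneg: "psum_le p A f B \<Longrightarrow> 0 \<le> B"
  using psum_leD[of p A f B "{}"] by simp

lemma psum_le_mono: "psum_le p A f B \<Longrightarrow> B \<le> B' \<Longrightarrow> psum_le p A f B'"
  unfolding psum_le_def by (meson order_trans)

lemma psum_le_point: "psum_le p A f B \<Longrightarrow> a \<in> A \<Longrightarrow> \<bar>f a\<bar> powr p \<le> B"
  using psum_leD[of p A f B "{a}"] by simp

lemma psum_le_cong: "(\<And>a. a \<in> A \<Longrightarrow> \<bar>f a\<bar> = \<bar>g a\<bar>) \<Longrightarrow> psum_le p A f B \<longleftrightarrow> psum_le p A g B"
proof -
  assume a: "\<And>a. a \<in> A \<Longrightarrow> \<bar>f a\<bar> = \<bar>g a\<bar>"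
  have "(\<Sum>a\<in>F. \<bar>f a\<bar> powr p) = (\<Sum>a\<in>F. \<bar>g a\<bar> powr p)" if "F \<subseteq> A" for F
    using that a by (intro sum.cong) auto
  then show ?thesis unfolding psum_le_def by auto
qed

lemma psum_le_infsum:
  assumes "psum_le p A f B"
  shows "(\<lambda>a. \<bar>f a\<bar> powr p) summable_on A" "(\<Sum>\<^sub>\<infinity>a\<in>A. \<bar>f a\<bar> powr p) \<le> B"
proof -
  show s: "(\<lambda>a. \<bar>f a\<bar> powr p) summable_on A"
    using assms by (intro nonneg_bdd_above_summable_on bdd_aboveI2[of _ _ B]) (auto simp: psum_le_def)
  show "(\<Sum>\<^sub>\<infinity>a\<in>A. \<bar>f a\<bar> powr p) \<le> B"
    by (rule infsum_le_finite_sums[OF s]) (use assms in \<open>auto simp: psum_le_def\<close>)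
qed

lemma infsum_psum_le:
  "(\<lambda>a. \<bar>f a\<bar> powr p) summable_on A \<Longrightarrow> psum_le p A f (\<Sum>\<^sub>\<infinity>a\<in>A. \<bar>f a\<bar> powr p)"
  unfolding psum_le_def by (auto intro!: finite_sum_le_infsum)

lemma ell_iff_summable_on: "u \<in> ell p \<longleftrightarrow> (\<lambda>j. \<bar>u j\<bar> powr p) summable_on UNIV"
  unfolding ell_def by (simp add: summable_on_UNIV_nonneg_real_iff)

lemma psum_le_imp_ell: "psum_le p UNIV u B \<Longrightarrow> u \<in> ell p"
  using psum_le_infsum ell_iff_summable_on by blast

text \<open>Every term is at most the largest one, whose power is among the summands on the right.
  This crude constant avoids convexity and serves as the quasi-triangle inequality.\<close>

lemma abs_sum_powr_le:
  fixes f :: "'i \<Rightarrow> real"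
  assumes "0 < p" "finite I"
  shows "\<bar>\<Sum>i\<in>I. f i\<bar> powr p \<le> real (card I) powr p * (\<Sum>i\<in>I. \<bar>f i\<bar> powr p)"
proof (cases "I = {}")
  case False
  define M where "M = Max ((\<lambda>i. \<bar>f i\<bar>) ` I)"
  have "M \<in> (\<lambda>i. \<bar>f i\<bar>) ` I" unfolding M_def using False assms by (intro Max_in) auto
  then obtain i0 where i0: "i0 \<in> I" "M = \<bar>f i0\<bar>" by auto
  have "\<bar>f i\<bar> \<le> M" if "i \<in> I" for i unfolding M_def using that assms by (intro Max_ge) auto
  then have "(\<Sum>i\<in>I. \<bar>f i\<bar>) \<le> real (card I) * M" by (rule sum_bounded_above)
  then have "\<bar>\<Sum>i\<in>I. f i\<bar> \<le> real (card I) * M" using sum_abs[of f I] by linarith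
  then have "\<bar>\<Sum>i\<in>I. f i\<bar> powr p \<le> (real (card I) * M) powr p"
    using assms by (intro powr_mono2) auto
  also have "\<dots> = real (card I) powr p * \<bar>f i0\<bar> powr p"
    using i0 by (simp add: powr_mult)
  also have "\<dots> \<le> real (card I) powr p * (\<Sum>i\<in>I. \<bar>f i\<bar> powr p)"
    using i0 assms by (intro mult_left_mono member_le_sum) auto
  finally show ?thesis .
qed simp

lemma psum_le_sum:
  assumes "0 < p" "finite I" "\<And>i. i \<in> I \<Longrightarrow> psum_le p A (f i) (B i)"
  shows "psum_le p A (\<lambda>a. \<Sum>i\<in>I. f i a) (real (card I) powr p * (\<Sum>i\<in>I. B i))"
  unfolding psum_le_def
proof (intro allI impI)
  fix F assume F: "finite F" "F \<subseteq> A"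
  have "(\<Sum>a\<in>F. \<bar>\<Sum>i\<in>I. f i a\<bar> powr p)
      \<le> (\<Sum>a\<in>F. real (card I) powr p * (\<Sum>i\<in>I. \<bar>f i a\<bar> powr p))"
    by (intro sum_mono abs_sum_powr_le assms)
  also have "\<dots> = real (card I) powr p * (\<Sum>i\<in>I. \<Sum>a\<in>F. \<bar>f i a\<bar> powr p)"
    by (simp add: sum_distrib_left[symmetric] sum.swap[of _ F])
  also have "\<dots> \<le> real (card I) powr p * (\<Sum>i\<in>I. B i)"
    using F by (intro mult_left_mono sum_mono psum_leD[OF assms(3)]) auto
  finally show "(\<Sum>a\<in>F. \<bar>\<Sum>i\<in>I. f i a\<bar> powr p) \<le> \<dots>" .
qed

lemma psum_le_diff:
  assumes "0 < p" "psum_le p A f a" "psum_le p A g b"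
  shows "psum_le p A (\<lambda>x. f x - g x) (2 powr p * (a + b))"
proof -
  have "psum_le p A (\<lambda>x. - g x) b" using psum_le_cong[of A "\<lambda>x. - g x" g] assms by simp
  then have "psum_le p A (\<lambda>x. \<Sum>i\<in>UNIV. (if i then f x else - g x))
      (real (card (UNIV :: bool set)) powr p * (\<Sum>i\<in>UNIV. if i then a else b))"
    using assms by (intro psum_le_sum) auto
  then show ?thesis by (simp add: UNIV_bool algebra_simps)
qed

lemma psum_le_cmult: "psum_le p A f B \<Longrightarrow> psum_le p A (\<lambda>a. c * f a) (\<bar>c\<bar> powr p * B)"
  unfolding psum_le_def by (simp add: abs_mult powr_mult sum_distrib_left[symmetric] mult_left_mono)

text \<open>The injection allows a finite sum over \<open>C\<close> to be enlarged to one over a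
  rectangle, where it factors. In the order \<open>b * a\<close>, a bound \<open>a = k * G u\<close>
  leaves the constants in front.\<close>

lemma psum_le_tensor:
  assumes f: "psum_le p A f a" and g: "psum_le p B g b"
    and \<phi>: "inj_on \<phi> C" "\<phi> ` C \<subseteq> A \<times> B"
  shows "psum_le p C (\<lambda>c. f (fst (\<phi> c)) * g (snd (\<phi> c))) (b * a)"
  unfolding psum_le_def
proof (intro allI impI)
  fix F assume F: "finite F" "F \<subseteq> C"
  define A' where "A' = fst ` \<phi> ` F"
  define B' where "B' = snd ` \<phi> ` F"
  have im: "\<phi> ` F \<subseteq> A \<times> B" using F \<phi> by blast
  have A': "finite A'" "A' \<subseteq> A"
    unfolding A'_def using F(1) im by (simp, intro image_subsetI, metis mem_Times_iff subsetD)
  have B': "finite B'" "B' \<subseteq> B"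
    unfolding B'_def using F(1) im by (simp, intro image_subsetI, metis mem_Times_iff subsetD)
  have "(\<Sum>c\<in>F. \<bar>f (fst (\<phi> c)) * g (snd (\<phi> c))\<bar> powr p)
      = (\<Sum>z\<in>\<phi> ` F. \<bar>f (fst z)\<bar> powr p * \<bar>g (snd z)\<bar> powr p)"
    using inj_on_subset[OF \<phi>(1) F(2)] by (simp add: sum.reindex abs_mult powr_mult)
  also have "\<dots> \<le> (\<Sum>z\<in>A' \<times> B'. \<bar>f (fst z)\<bar> powr p * \<bar>g (snd z)\<bar> powr p)"
  proof (rule sum_mono2)
    show "\<phi> ` F \<subseteq> A' \<times> B'"
      unfolding A'_def B'_def by (intro subsetI) (simp add: mem_Times_iff)
  qed (use A' B' in auto)
  also have "\<dots> = (\<Sum>x\<in>A'. \<bar>f x\<bar> powr p) * (\<Sum>y\<in>B'. \<bar>g y\<bar> powr p)"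
    by (simp add: sum_product sum.cartesian_product case_prod_beta)
  also have "\<dots> \<le> a * b"
    using psum_leD[OF f A'] psum_leD[OF g B'] psum_le_nonneg[OF f]
    by (intro mult_mono) (auto intro: sum_nonneg)
  finally show "(\<Sum>c\<in>F. \<bar>f (fst (\<phi> c)) * g (snd (\<phi> c))\<bar> powr p) \<le> b * a"
    by (simp add: mult.commute)
qed

section \<open>Uniform domination\<close>

text \<open>
  \<open>F u\<close> has \<open>p\<close>-th power sum at most a constant times \<open>G u\<close>, uniformly in \<open>u\<close>. Suppressing
  the constant lets such estimates be composed without tracking it.
\<close>

definition dominated ::
    "real \<Rightarrow> 'a set \<Rightarrow> 'u set \<Rightarrow> ('u \<Rightarrow> real) \<Rightarrow> ('u \<Rightarrow> 'a \<Rightarrow> real) \<Rightarrow> bool"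
  where "dominated p A U G F \<longleftrightarrow> (\<exists>c\<ge>0. \<forall>u\<in>U. psum_le p A (F u) (c * G u))"

lemma dominated_sum:
  assumes "0 < p" "finite I" "\<And>i. i \<in> I \<Longrightarrow> dominated p A U G (F i)"
  shows "dominated p A U G (\<lambda>u a. \<Sum>i\<in>I. F i u a)"
proof -
  have "\<forall>i\<in>I. \<exists>c\<ge>0. \<forall>u\<in>U. psum_le p A (F i u) (c * G u)"
    using assms(3) by (simp add: dominated_def)
  then obtain c where c: "\<And>i. i \<in> I \<Longrightarrow> c i \<ge> 0"
    "\<And>i u. i \<in> I \<Longrightarrow> u \<in> U \<Longrightarrow> psum_le p A (F i u) (c i * G u)" by metis
  show ?thesis unfolding dominated_def
  proof (intro exI conjI ballI)
    show "0 \<le> real (card I) powr p * (\<Sum>i\<in>I. c i)" using c by (simp add: sum_nonneg)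
    fix u assume "u \<in> U"
    then have "psum_le p A (\<lambda>a. \<Sum>i\<in>I. F i u a) (real (card I) powr p * (\<Sum>i\<in>I. c i * G u))"
      using c assms by (intro psum_le_sum) auto
    then show "psum_le p A (\<lambda>a. \<Sum>i\<in>I. F i u a) (real (card I) powr p * (\<Sum>i\<in>I. c i) * G u)"
      by (simp add: sum_distrib_right mult.assoc)
  qed
qed

lemma dominated_diff:
  assumes "0 < p" "dominated p A U G F1" "dominated p A U G F2"
  shows "dominated p A U G (\<lambda>u a. F1 u a - F2 u a)"
proof -
  obtain c1 c2 where c: "c1 \<ge> 0" "c2 \<ge> 0"
    "\<And>u. u \<in> U \<Longrightarrow> psum_le p A (F1 u) (c1 * G u)" "\<And>u. u \<in> U \<Longrightarrow> psum_le p A (F2 u) (c2 * G u)"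
    using assms unfolding dominated_def by metis
  show ?thesis unfolding dominated_def
  proof (intro exI conjI ballI)
    show "0 \<le> 2 powr p * (c1 + c2)" using c by simp
    fix u assume "u \<in> U"
    then have "psum_le p A (\<lambda>a. F1 u a - F2 u a) (2 powr p * (c1 * G u + c2 * G u))"
      using c assms by (intro psum_le_diff) auto
    then show "psum_le p A (\<lambda>a. F1 u a - F2 u a) (2 powr p * (c1 + c2) * G u)"
      by (simp add: distrib_right mult.assoc)
  qed
qed

lemma dominated_tensor:
  assumes F: "dominated p A U G F" and g: "psum_le p B g b"
    and \<phi>: "inj_on \<phi> C" "\<phi> ` C \<subseteq> A \<times> B"
  shows "dominated p C U G (\<lambda>u c. F u (fst (\<phi> c)) * g (snd (\<phi> c)))"
proof -
  obtain k where k: "k \<ge> 0" "\<And>u. u \<in> U \<Longrightarrow> psum_le p A (F u) (k * G u)"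
    using F unfolding dominated_def by auto
  have "psum_le p C (\<lambda>c. F u (fst (\<phi> c)) * g (snd (\<phi> c))) (b * k * G u)" if "u \<in> U" for u
    using psum_le_tensor[OF k(2)[OF that] g \<phi>] by (simp add: mult.assoc)
  moreover have "0 \<le> b * k" using psum_le_nonneg[OF g] k by simp
  ultimately show ?thesis unfolding dominated_def by blast
qed

lemma dominated_reindex:
  assumes "dominated p A U G F" "inj_on h C" "h ` C \<subseteq> A"
  shows "dominated p C U G (\<lambda>u c. F u (h c) * k)"
proof -
  \<comment> \<open>The scalar \<open>k\<close> is regarded as a function on a one-point set, so
    that scaling and reindexing become a case of the tensor estimate.\<close>
  have "psum_le p {()} (\<lambda>_. k) (\<bar>k\<bar> powr p)"
    unfolding psum_le_def by (auto simp: subset_singleton_iff)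
  from dominated_tensor[OF assms(1) this, of "\<lambda>c. (h c, ())" C] show ?thesis
    using assms(2,3) by (auto simp: inj_on_def)
qed

text \<open>Here the first tensor factor is frozen at one index. This handles a minor of
  \<open>u\<close> in fixed columns multiplied by a fixed sequence.\<close>

lemma dominated_eval:
  assumes "dominated p A U G F" "a \<in> A" "psum_le p B g b"
  shows "dominated p B U G (\<lambda>u c. F u a * g c)"
  using dominated_tensor[OF assms(1,3), of "\<lambda>c. (a, c)" B] assms(2) by (auto simp: inj_on_def)

lemma dominated_cong:
  "(\<And>u a. u \<in> U \<Longrightarrow> a \<in> A \<Longrightarrow> F u a = F' u a) \<Longrightarrow> dominated p A U G F \<longleftrightarrow> dominated p A U G F'"
  unfolding dominated_def by (intro ex_cong1 conj_cong refl ball_cong psum_le_cong) auto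

section \<open>Laplace expansion of minors and nonvanishing minors\<close>

lemma length_omit: "i < length xs \<Longrightarrow> length (omit i xs) = length xs - 1"
  by (simp add: omit_def)

lemma nth_omit:
  "i < length xs \<Longrightarrow> a < length xs - 1 \<Longrightarrow> omit i xs ! a = xs ! (if a < i then a else Suc a)"
  by (auto simp: omit_def nth_append min_def)

lemma omit_Cons: "omit 0 (x # xs) = xs" "omit (Suc i) (x # xs) = x # omit i xs"
  by (simp_all add: omit_def)

lemma set_omit: "set (omit i xs) \<subseteq> set xs"
  unfolding omit_def using set_take_subset set_drop_subset by fastforce

text \<open>Makes \<open>js \<mapsto> (js ! k, omit k js)\<close> injective, as the tensor estimate
  requires for the terms of a row expansion.\<close>

lemma omit_inj:
  assumes "length js = length js'" "k < length js" "js ! k = js' ! k" "omit k js = omit k js'"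
  shows "js = js'"
proof -
  have "take k js = take k js'" "drop (Suc k) js = drop (Suc k) js'"
    using assms by (auto simp: omit_def append_eq_append_conv)
  then show ?thesis using assms id_take_nth_drop[of k js] id_take_nth_drop[of k js'] by metis
qed

text \<open>The index shift of \<open>mat_delete\<close> is that of \<open>omit\<close>, so
  cofactors become signed minors of shorter lists.\<close>

lemma mat_delete_minor:
  assumes "length js = length xs" "i < length xs" "k < length xs"
  shows "Determinant.det (mat_delete (Matrix.mat (length xs) (length xs) (\<lambda>(i, k). (xs ! i) (js ! k))) i k)
    = minor (omit i xs) (omit k js)"
  unfolding minor_def mat_delete_def
  using assms by (intro arg_cong[of _ _ Determinant.det] eq_matI) (auto simp: length_omit nth_omit)

lemma minor_expand_row:
  assumes "length js = length xs" "i < length xs"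
  shows "minor xs js
    = (\<Sum>k<length xs. (-1) ^ (i + k) * (xs ! i) (js ! k) * minor (omit i xs) (omit k js))"
proof -
  let ?A = "Matrix.mat (length xs) (length xs) (\<lambda>(i, k). (xs ! i) (js ! k))"
  have "minor xs js = (\<Sum>k<length xs. ?A $$ (i, k) * cofactor ?A i k)"
    unfolding minor_def by (rule laplace_expansion_row) (use assms in auto)
  also have "\<dots> = (\<Sum>k<length xs. (-1) ^ (i + k) * (xs ! i) (js ! k) * minor (omit i xs) (omit k js))"
    using assms by (intro sum.cong) (auto simp: cofactor_def mat_delete_minor)
  finally show ?thesis .
qed

lemma minor_expand_column:
  assumes "length js = length xs" "k < length xs"
  shows "minor xs js
    = (\<Sum>i<length xs. (-1) ^ (i + k) * (xs ! i) (js ! k) * minor (omit i xs) (omit k js))"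
proof -
  let ?A = "Matrix.mat (length xs) (length xs) (\<lambda>(i, k). (xs ! i) (js ! k))"
  have "minor xs js = (\<Sum>i<length xs. ?A $$ (i, k) * cofactor ?A i k)"
    unfolding minor_def by (rule laplace_expansion_column) (use assms in auto)
  also have "\<dots> = (\<Sum>i<length xs. (-1) ^ (i + k) * (xs ! i) (js ! k) * minor (omit i xs) (omit k js))"
    using assms by (intro sum.cong) (auto simp: cofactor_def mat_delete_minor)
  finally show ?thesis .
qed

text \<open>Expansion along the column \<open>j\<close>, with the row of \<open>u\<close> split off.
  The row of \<open>xs ! i\<close> has index \<open>Suc i\<close>, which accounts for the minus
  sign.\<close>

lemma minor_Cons_Cons:
  assumes "length js = length xs"
  shows "minor (u # xs) (j # js) = u j * minor xs js
    - (\<Sum>i<length xs. (xs ! i) j * ((-1) ^ i * minor (u # omit i xs) js))"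
  using minor_expand_column[of "j # js" "u # xs" 0] assms
  by (simp add: sum.lessThan_Suc_shift omit_Cons sum_negf[symmetric] mult_ac del: sum.lessThan_Suc)

lemma minor_Nil: "minor [] js = 1"
  by (simp add: minor_def)

text \<open>Induction: keep columns \<open>js\<close> that are good for the tail and put one more
  column \<open>j\<close> in front. If the minor vanished for every \<open>j\<close>, expansion
  along that column would express \<open>y\<close> through the tail.\<close>

lemma minor_nonzero_of_independent:
  assumes "distinct ys" "independent (set ys)"
  shows "\<exists>js. length js = length ys \<and> minor ys js \<noteq> 0"
  using assms
proof (induction ys)
  case (Cons y ys)
  have "independent (set ys)" using independent_mono[OF Cons.prems(2)] by auto
  then obtain js where js: "length js = length ys" "minor ys js \<noteq> 0"
    using Cons by auto
  have y: "y \<notin> span (set ys)"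
    using Cons.prems by (auto simp: independent_insert)
  show ?case
  proof (rule ccontr)
    assume "\<not> ?thesis"
    then have z: "minor (y # ys) (j # js) = 0" for j using js by (metis length_Cons)
    define w where "w = (\<Sum>i<length ys. ((-1) ^ i * minor (y # omit i ys) js) *\<^sub>R (ys ! i))"
    have "minor ys js *\<^sub>R y = w"
    proof
      fix j
      have "w j = (\<Sum>i<length ys. (ys ! i) j * ((-1) ^ i * minor (y # omit i ys) js))"
        unfolding w_def by (induction rule: infinite_finite_induct[of _ "{..<length ys}"])
          (auto simp: scaleR_fun_def mult_ac)
      then show "(minor ys js *\<^sub>R y) j = w j"
        using z[of j] minor_Cons_Cons[OF js(1), of y j] by (simp add: scaleR_fun_def mult.commute)
    qed
    then have "y = inverse (minor ys js) *\<^sub>R w" using js by auto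
    moreover have "w \<in> span (set ys)"
      unfolding w_def by (intro span_sum span_scale span_base) auto
    ultimately show False using y span_scale by blast
  qed
qed (simp add: minor_Nil)

section \<open>Comparison of minors with the norm of \<open>u\<close>\<close>

text \<open>In the expansion along the row of \<open>u\<close>, each term is a tensor product of
  \<open>u\<close> and \<open>minor xs\<close>, by splitting \<open>js\<close> into its
  \<open>k\<close>-th entry and the rest.\<close>

lemma dominated_minor_aux:
  assumes "0 < p" "psum_le p {js. length js = length xs} (minor xs) b"
  shows "dominated p {js. length js = Suc (length xs)} (ell p)
    (\<lambda>u. \<Sum>\<^sub>\<infinity>j. \<bar>u j\<bar> powr p) (\<lambda>u. minor (u # xs))"
proof -
  let ?C = "{js :: nat list. length js = Suc (length xs)}"
  let ?G = "\<lambda>u :: nat \<Rightarrow> real. \<Sum>\<^sub>\<infinity>j. \<bar>u j\<bar> powr p"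
  have base: "dominated p UNIV (ell p) ?G (\<lambda>u. u)"
    unfolding dominated_def by (rule exI[of _ 1]) (auto simp: ell_iff_summable_on infsum_psum_le)
  have summand: "dominated p ?C (ell p) ?G (\<lambda>u js. u (js ! k) * ((-1) ^ k * minor xs (omit k js)))"
    if k: "k < Suc (length xs)" for k
  proof -
    have g: "psum_le p {js. length js = length xs} (\<lambda>js. (-1) ^ k * minor xs js) b"
      using psum_le_cong[THEN iffD2, OF _ assms(2)] by (simp add: abs_mult power_abs)
    have inj: "inj_on (\<lambda>js. (js ! k, omit k js)) ?C"
    proof (rule inj_onI)
      fix js js' assume "js \<in> ?C" "js' \<in> ?C" "(js ! k, omit k js) = (js' ! k, omit k js')"
      then show "js = js'" using k by (intro omit_inj[of js js' k]) auto
    qed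
    have "(\<lambda>js. (js ! k, omit k js)) ` ?C \<subseteq> UNIV \<times> {js. length js = length xs}"
      using k by (auto simp: length_omit)
    from dominated_tensor[OF base g inj this] show ?thesis by simp
  qed
  have "dominated p ?C (ell p) ?G
      (\<lambda>u js. \<Sum>k<Suc (length xs). u (js ! k) * ((-1) ^ k * minor xs (omit k js)))"
    using assms(1) summand by (intro dominated_sum) auto
  also have "?this \<longleftrightarrow> dominated p ?C (ell p) ?G (\<lambda>u. minor (u # xs))"
    by (intro dominated_cong) (simp add: minor_expand_row[where i = 0] omit_Cons mult_ac
      del: sum.lessThan_Suc)
  finally show ?thesis .
qed

lemma minor_psum_le:
  assumes "0 < p" "set xs \<subseteq> ell p"
  shows "\<exists>b. psum_le p {js. length js = length xs} (minor xs) b"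
  using assms(2)
proof (induction xs)
  case Nil
  then show ?case
    by (intro exI[of _ 1]) (auto simp: psum_le_def subset_singleton_iff minor_Nil)
next
  case (Cons x xs)
  then obtain b where "psum_le p {js. length js = length xs} (minor xs) b" by auto
  from dominated_minor_aux[OF assms(1) this] show ?case
    using Cons.prems unfolding dominated_def by auto
qed

lemma dominated_minor:
  assumes "0 < p" "set xs \<subseteq> ell p"
  shows "dominated p {js. length js = Suc (length xs)} (ell p)
    (\<lambda>u. \<Sum>\<^sub>\<infinity>j. \<bar>u j\<bar> powr p) (\<lambda>u. minor (u # xs))"
  using minor_psum_le[OF assms] dominated_minor_aux[OF assms(1)] by blast

lemma dominated_by_minors:
  assumes p: "0 < p" and ys: "ys \<noteq> []" "distinct ys" "set ys \<subseteq> ell p" "independent (set ys)"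
  shows "dominated p UNIV (ell p)
    (\<lambda>u. \<Sum>i<length ys. \<Sum>\<^sub>\<infinity>js\<in>{js. length js = length ys}. \<bar>minor (u # omit i ys) js\<bar> powr p)
    (\<lambda>u. u)"
proof -
  let ?n = "length ys"
  let ?P = "{js :: nat list. length js = ?n}"
  define G where "G = (\<lambda>u. \<Sum>i<?n. \<Sum>\<^sub>\<infinity>js\<in>?P. \<bar>minor (u # omit i ys) js\<bar> powr p)"
  have M: "dominated p ?P (ell p) G (\<lambda>u. minor (u # omit i ys))" if i: "i < ?n" for i
  proof -
    have l: "Suc (length (omit i ys)) = ?n" using i by (simp add: length_omit)
    have sub: "set (omit i ys) \<subseteq> ell p" by (rule order_trans[OF set_omit ys(3)])
    \<comment> \<open>This bound only ensures that the sums in \<open>G\<close> converge; a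
      divergent one would have the value 0 and dominate nothing.\<close>
    obtain k where k: "\<And>u. u \<in> ell p \<Longrightarrow>
        psum_le p ?P (minor (u # omit i ys)) (k * (\<Sum>\<^sub>\<infinity>j. \<bar>u j\<bar> powr p))"
      using dominated_minor[OF p sub] unfolding dominated_def l by auto
    have "psum_le p ?P (minor (u # omit i ys)) (1 * G u)" if u: "u \<in> ell p" for u
      using infsum_psum_le[OF psum_le_infsum(1)[OF k[OF u]]]
    proof (rule psum_le_mono)
      show "(\<Sum>\<^sub>\<infinity>js\<in>?P. \<bar>minor (u # omit i ys) js\<bar> powr p) \<le> 1 * G u"
        unfolding G_def mult_1
        by (rule member_le_sum[of i "{..<?n}" "\<lambda>i. \<Sum>\<^sub>\<infinity>js\<in>?P. \<bar>minor (u # omit i ys) js\<bar> powr p"])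
          (use i in \<open>auto intro: infsum_nonneg\<close>)
    qed
    then show ?thesis unfolding dominated_def by (intro exI[of _ 1] conjI ballI) simp_all
  qed
  obtain js where js: "length js = ?n" "minor ys js \<noteq> 0"
    using minor_nonzero_of_independent[OF ys(2,4)] by blast
  have fin: "\<exists>b. psum_le p UNIV (\<lambda>j. c * (ys ! i) j) b" if i: "i < ?n" for i c
  proof -
    have "ys ! i \<in> ell p" using i ys(3) by auto
    then have "psum_le p UNIV (ys ! i) (\<Sum>\<^sub>\<infinity>j. \<bar>(ys ! i) j\<bar> powr p)"
      by (simp add: ell_iff_summable_on infsum_psum_le)
    from psum_le_cmult[OF this] show ?thesis by (rule exI)
  qed
  \<comment> \<open>\<open>V\<close> is the part of the column expansion of \<open>W\<close> that
    does not contain \<open>u j\<close>, with its sign. The columns \<open>js\<close> are fixed, so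
    its coefficients are single values of minors.\<close>
  have V: "dominated p UNIV (ell p) G
      (\<lambda>u j. \<Sum>i<?n. minor (u # omit i ys) js * (- ((-1) ^ i) * (ys ! i) j))"
  proof (intro dominated_sum p)
    fix i assume "i \<in> {..<?n}"
    then have i: "i < ?n" by simp
    obtain b where "psum_le p UNIV (\<lambda>j. - ((-1) ^ i) * (ys ! i) j) b" using fin[OF i] by blast
    from dominated_eval[OF M[OF i] _ this, of js]
    show "dominated p UNIV (ell p) G (\<lambda>u j. minor (u # omit i ys) js * (- ((-1) ^ i) * (ys ! i) j))"
      using js(1) by simp
  qed simp
  have W: "dominated p UNIV (ell p) G (\<lambda>u j. minor (u # ys) (j # js))"
  proof -
    have n: "0 < ?n" using ys(1) by simp
    have "dominated p UNIV (ell p) G (\<lambda>u j. \<Sum>k<Suc ?n.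
        (-1) ^ (1 + k) * (ys ! 0) ((j # js) ! k) * minor (u # omit 0 ys) (omit k (j # js)))"
    proof (intro dominated_sum p)
      fix k assume k: "k \<in> {..<Suc ?n}"
      show "dominated p UNIV (ell p) G
        (\<lambda>u j. (-1) ^ (1 + k) * (ys ! 0) ((j # js) ! k) * minor (u # omit 0 ys) (omit k (j # js)))"
      proof (cases k)
        \<comment> \<open>The column \<open>j\<close> is deleted: a minor in the fixed columns
          \<open>js\<close> remains, multiplied by the sequence \<open>ys ! 0\<close>.\<close>
        case 0
        obtain b where "psum_le p UNIV (\<lambda>j. - 1 * (ys ! 0) j) b" using fin n by blast
        from dominated_eval[OF M[OF n] _ this, of js] show ?thesis
          using 0 js(1) by (simp add: omit_Cons mult.commute)
      next
        \<comment> \<open>The entry of \<open>ys ! 0\<close> is now a constant and \<open>j\<close>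
          survives as a column of the minor, so the estimate is a reindexing along
          \<open>j \<mapsto> j # omit k' js\<close>.\<close>
        case (Suc k')
        have "inj_on (\<lambda>j. j # omit k' js) UNIV" "range (\<lambda>j. j # omit k' js) \<subseteq> ?P"
          using k Suc js(1) by (auto simp: inj_on_def length_omit)
        from dominated_reindex[OF M[OF n] this, of "(-1) ^ k' * (ys ! 0) (js ! k')"] show ?thesis
          using Suc by (simp add: omit_Cons mult.commute)
      qed
    qed simp
    also have "?this \<longleftrightarrow> ?thesis"
    proof (intro dominated_cong)
      fix u j
      show "(\<Sum>k<Suc ?n. (-1) ^ (1 + k) * (ys ! 0) ((j # js) ! k)
          * minor (u # omit 0 ys) (omit k (j # js))) = minor (u # ys) (j # js)"
        using minor_expand_row[of "j # js" "u # ys" 1] js(1) n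
        by (simp add: omit_Cons del: sum.lessThan_Suc)
    qed
    finally show ?thesis .
  qed
  \<comment> \<open>Since \<open>W - V\<close> is \<open>minor ys js * u j\<close>, dividing by the
    nonzero minor recovers \<open>u\<close>.\<close>
  have "dominated p UNIV (ell p) G (\<lambda>u j. (minor (u # ys) (j # js)
      - (\<Sum>i<?n. minor (u # omit i ys) js * (- ((-1) ^ i) * (ys ! i) j))) * inverse (minor ys js))"
    using dominated_reindex[OF dominated_diff[OF p W V], of id UNIV] by simp
  also have "?this \<longleftrightarrow> dominated p UNIV (ell p) G (\<lambda>u. u)"
  proof (rule dominated_cong)
    fix u j
    have "(\<Sum>i<?n. minor (u # omit i ys) js * (- ((-1) ^ i) * (ys ! i) j))
        = - (\<Sum>i<?n. (ys ! i) j * ((-1) ^ i * minor (u # omit i ys) js))"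
      unfolding sum_negf[symmetric] by (intro sum.cong refl) simp
    then show "(minor (u # ys) (j # js)
        - (\<Sum>i<?n. minor (u # omit i ys) js * (- ((-1) ^ i) * (ys ! i) j))) * inverse (minor ys js) = u j"
      using js(2) unfolding minor_Cons_Cons[OF js(1)] by simp
  qed
  finally show ?thesis unfolding G_def .
qed

section \<open>Banach's argument for a gauge equivalent to the norm\<close>

text \<open>Differences are estimated through \<open>p\<close>-th power sums by
  \<open>psum_le_diff\<close>; \<open>c1\<close> and \<open>c2\<close> carry the estimates from
  \<open>q\<close> to these sums and back.\<close>

lemma ell_contraction_fixed_point:
  fixes q :: "(nat \<Rightarrow> real) \<Rightarrow> real"
  assumes p: "0 < p" and K: "K \<subseteq> ell p" "K \<noteq> {}"
    and q0: "\<And>u. 0 \<le> q u"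
    and c1: "0 \<le> c1" "\<And>u. u \<in> ell p \<Longrightarrow> psum_le p UNIV u (c1 * q u powr p)"
    and c2: "0 \<le> c2" "\<And>u B. psum_le p UNIV u B \<Longrightarrow> q u \<le> c2 * B powr (1 / p)"
    and closed: "\<And>x l. (\<And>k. x k \<in> K) \<Longrightarrow> l \<in> ell p \<Longrightarrow> (\<lambda>k. q (x k - l)) \<longlonglongrightarrow> 0 \<Longrightarrow> l \<in> K"
    and bounded: "\<And>x. x \<in> K \<Longrightarrow> q x \<le> M"
    and T: "T \<in> K \<rightarrow> K"
    and C: "0 < C" "C < 1" "\<And>x y. x \<in> K \<Longrightarrow> y \<in> K \<Longrightarrow> q (T x - T y) \<le> C * q (x - y)"
  shows "\<exists>!x. x \<in> K \<and> T x = x"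
proof -
  have diff: "psum_le p UNIV (u - v) (2 powr p * (a + b))"
    if "psum_le p UNIV u a" "psum_le p UNIV v b" for u v :: "nat \<Rightarrow> real" and a b
    using psum_le_diff[OF p that] by (simp add: fun_diff_def)
  have commute: "psum_le p UNIV (u - v) a \<longleftrightarrow> psum_le p UNIV (v - u) a" for u v :: "nat \<Rightarrow> real" and a
    by (rule psum_le_cong) (simp add: abs_minus_commute)
  have ell_diff: "u - v \<in> ell p" if "u \<in> ell p" "v \<in> ell p" for u v
    using diff[OF c1(2) c1(2)] that psum_le_imp_ell by blast
  have zero: "u = v" if "psum_le p UNIV (u - v) a" "a \<le> 0" for u v :: "nat \<Rightarrow> real" and a
  proof
    fix j
    have "\<bar>u j - v j\<bar> powr p \<le> 0"
      using order_trans[OF psum_le_point[OF that(1), of j] that(2)] by simp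
    then show "u j = v j" by simp
  qed
  have unique: "x = y" if "x \<in> K" "y \<in> K" "T x = x" "T y = y" for x y
  proof -
    have "(1 - C) * q (x - y) \<le> 0" using C(3)[OF that(1,2)] that by (simp add: algebra_simps)
    then have "q (x - y) = 0" using C(2) q0[of "x - y"] by (simp add: mult_le_0_iff)
    moreover have "x \<in> ell p" "y \<in> ell p" using that K by auto
    ultimately show ?thesis using zero[OF c1(2)[OF ell_diff[of x y]]] by simp
  qed
  obtain a where a: "a \<in> K" using K by blast
  define x where "x k = (T ^^ k) a" for k
  have xS: "x (Suc k) = T (x k)" for k by (simp add: x_def)
  have xK: "x k \<in> K" for k
    by (induction k) (use a T in \<open>auto simp: x_def\<close>)
  then have xell: "x k \<in> ell p" for k using K by blast
  \<comment> \<open>A bound for the \<open>q\<close>-diameter of \<open>K\<close>: both points have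
    power sums at most \<open>c1 * M powr p\<close>, their difference costs \<open>2 powr p\<close>,
    and \<open>c2\<close> leads back to \<open>q\<close>.\<close>
  define B where "B = c2 * (2 powr p * (c1 * M powr p + c1 * M powr p)) powr (1 / p)"
  have qB: "q (u - v) \<le> B" if "u \<in> K" "v \<in> K" for u v
  proof -
    have "psum_le p UNIV w (c1 * M powr p)" if "w \<in> K" for w
      using that K bounded[OF that] q0[of w] p c1
      by (intro psum_le_mono[OF c1(2)[of w]] mult_left_mono powr_mono2) auto
    from c2(2)[OF diff[OF this this]] that show ?thesis unfolding B_def by blast
  qed
  have B0: "0 \<le> B" using qB[OF a a] q0[of "a - a"] by linarith
  have qx: "q (x k - x (k + r)) \<le> C ^ k * B" for k r
  proof (induction k)
    case 0
    then show ?case using qB[OF xK[of 0] xK[of r]] by (simp only: power_0 mult_1 add_0)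
  next
    case (Suc k)
    have "q (x (Suc k) - x (Suc k + r)) \<le> C * q (x k - x (k + r))"
      using C(3) xK by (simp add: xS)
    also have "\<dots> \<le> C * (C ^ k * B)" by (rule mult_left_mono[OF Suc.IH less_imp_le[OF C(1)]])
    finally show ?case by (simp only: power_Suc mult.assoc)
  qed
  \<comment> \<open>The estimate \<open>qx\<close> in terms of power sums; it does not depend on
    \<open>r\<close>.\<close>
  define e where "e k = c1 * (C ^ k * B) powr p" for k
  have e: "psum_le p UNIV (x k - x (k + r)) (e k)" for k r
    using c1 qx[of k r] q0 p unfolding e_def
    by (intro psum_le_mono[OF c1(2)[OF ell_diff[OF xell xell]]] mult_left_mono powr_mono2) auto
  have "(\<lambda>k. C ^ k * B) \<longlonglongrightarrow> 0 * B"
    using C by (intro tendsto_intros LIMSEQ_realpow_zero) auto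
  then have "e \<longlonglongrightarrow> c1 * (0 * B) powr p"
    unfolding e_def using p C B0 by (intro tendsto_intros tendsto_powr') auto
  then have e0: "e \<longlonglongrightarrow> 0" by simp
  have ep0: "(\<lambda>k. e k powr (1 / p)) \<longlonglongrightarrow> 0"
    using tendsto_powr'[OF e0 tendsto_const, of "1 / p"] p c1 by (simp add: e_def)
  \<comment> \<open>Each coordinate is controlled by the whole power sum, so the limit is built
    coordinatewise.\<close>
  have "convergent (\<lambda>k. x k j)" for j
  proof (rule Cauchy_convergent, rule metric_CauchyI)
    fix \<epsilon> :: real assume \<epsilon>: "\<epsilon> > 0"
    have "eventually (\<lambda>k. e k < (\<epsilon> / 2) powr p) sequentially"
      using e0 \<epsilon> by (intro order_tendstoD) auto
    then obtain k where k: "e k < (\<epsilon> / 2) powr p"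
      using eventually_happens by (metis sequentially_bot)
    have d: "\<bar>x k j - x i j\<bar> < \<epsilon> / 2" if i: "i \<ge> k" for i
    proof (rule ccontr)
      assume "\<not> ?thesis"
      then have "(\<epsilon> / 2) powr p \<le> \<bar>x k j - x i j\<bar> powr p" using \<epsilon> p by (intro powr_mono2) auto
      also have "\<dots> \<le> e k" using psum_le_point[OF e[of k "i - k"], of j] i by simp
      finally show False using k by simp
    qed
    show "\<exists>N. \<forall>m\<ge>N. \<forall>n\<ge>N. dist (x m j) (x n j) < \<epsilon>"
    proof (intro exI allI impI)
      fix m n assume "k \<le> m" "k \<le> n"
      then show "dist (x m j) (x n j) < \<epsilon>" using d[of m] d[of n] unfolding dist_real_def by arith
    qed
  qed
  then obtain l where l: "\<And>j. (\<lambda>k. x k j) \<longlonglongrightarrow> l j" unfolding convergent_def by metis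
  \<comment> \<open>Let \<open>r\<close> tend to infinity in each finite partial sum of
    \<open>e\<close>.\<close>
  have el: "psum_le p UNIV (x k - l) (e k)" for k
    unfolding psum_le_def
  proof (intro allI impI)
    fix F :: "nat set" assume F: "finite F"
    have lim: "(\<lambda>r. \<Sum>j\<in>F. \<bar>x k j - x (r + k) j\<bar> powr p) \<longlonglongrightarrow> (\<Sum>j\<in>F. \<bar>x k j - l j\<bar> powr p)"
      using p LIMSEQ_ignore_initial_segment[OF l] by (intro tendsto_intros tendsto_powr') auto
    have "(\<Sum>j\<in>F. \<bar>x k j - l j\<bar> powr p) \<le> e k"
      by (rule LIMSEQ_le_const2[OF lim])
        (use psum_leD[OF e[of k] F] in \<open>auto simp: add.commute\<close>)
    then show "(\<Sum>j\<in>F. \<bar>(x k - l) j\<bar> powr p) \<le> e k" by simp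
  qed
  \<comment> \<open>\<open>l\<close> is written as a difference of two members of
    \<open>ell p\<close>.\<close>
  have "x 0 - (x 0 - l) \<in> ell p"
    using ell_diff[OF xell psum_le_imp_ell[OF el]] .
  then have lell: "l \<in> ell p" by simp
  have "(\<lambda>k. q (x k - l)) \<longlonglongrightarrow> 0"
  proof (rule tendsto_sandwich[OF _ _ tendsto_const])
    show "(\<lambda>k. c2 * e k powr (1 / p)) \<longlonglongrightarrow> 0" using tendsto_mult_left[OF ep0, of c2] by simp
  qed (use q0 c2(2)[OF el] in auto)
  then have lK: "l \<in> K" using closed[of x] xK lell by blast
  \<comment> \<open>\<open>T l - l\<close> is split at \<open>x (Suc k) = T (x k)\<close>:
    contraction bounds the first part by way of \<open>q (l - x k)\<close>, and
    \<open>e (Suc k)\<close> bounds the second.\<close>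
  define d where "d k = 2 powr p * (c1 * (C * (c2 * e k powr (1 / p))) powr p + e (Suc k))" for k
  have dk: "psum_le p UNIV (T l - l) (d k)" for k
  proof -
    have "T l \<in> ell p" using T lK K by blast
    moreover have "q (T l - x (Suc k)) \<le> C * (c2 * e k powr (1 / p))"
      using C(3)[OF lK xK, of k] c2(2)[OF commute[THEN iffD1, OF el], of k] C(1)
      unfolding xS by (meson mult_left_mono less_imp_le order_trans)
    ultimately have "psum_le p UNIV (T l - x (Suc k)) (c1 * (C * (c2 * e k powr (1 / p))) powr p)"
      using c1 q0 p
      by (intro psum_le_mono[OF c1(2)[OF ell_diff[OF _ xell]]] mult_left_mono powr_mono2) auto
    from diff[OF this commute[THEN iffD1, OF el[of "Suc k"]]] show ?thesis
      unfolding d_def by simp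
  qed
  have "d \<longlonglongrightarrow> 2 powr p * (c1 * (C * (c2 * 0)) powr p + 0)"
    unfolding d_def using p C c2(1) LIMSEQ_Suc[OF e0]
    by (intro tendsto_intros tendsto_powr' ep0) auto
  then have "d \<longlonglongrightarrow> 0" by simp
  then have "psum_le p UNIV (T l - l) 0"
    unfolding psum_le_def using psum_leD[OF dk] by (meson LIMSEQ_le_const)
  then have "T l = l" using zero by blast
  then show ?thesis using lK unique by blast
qed

section \<open>Application to the class norms\<close>

theorem theorem5p6:
  fixes p :: real and n m :: nat
    and ys :: "(nat \<Rightarrow> real) list"
    and K :: "(nat \<Rightarrow> real) set"
    and T :: "(nat \<Rightarrow> real) \<Rightarrow> (nat \<Rightarrow> real)"
  assumes "1 \<le> p" and "1 \<le> n"
    and "length ys = n" and "distinct ys" and "set ys \<subseteq> ell p" and "independent (set ys)"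
    and "m \<in> {1..n}"
    and "K \<subseteq> ell p" and "K \<noteq> {}"
    and "class_closed p ys m K" and "class_bounded p ys m K"
    and "T \<in> K \<rightarrow> K"
    and "class_contractive p ys m K T"
  shows "\<exists>!x. x \<in> K \<and> T x = x"
proof -
  have p: "0 < p" using assms(1) by simp
  let ?J = "index_sets n m"
  let ?N = "\<lambda>i u. n_norm p (u # omit i ys)"
  define S where "S i u = (\<Sum>\<^sub>\<infinity>js\<in>{js. length js = n}. \<bar>minor (u # omit i ys) js\<bar> powr p)" for i u
  define Q where "Q I u = (\<Sum>i\<in>I. ?N i u)" for I u
  \<comment> \<open>The contraction constant is common to all index sets, so it survives summation
    over them.\<close>
  define q where "q u = (\<Sum>I\<in>?J. Q I u)" for u
  have Q: "quotient_norm p ys I (coset ys I u) = Q I u" for I u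
    unfolding Q_def by (rule quotient_norm_coset)
  have finJ: "finite ?J" unfolding index_sets_def by (rule finite_subset[of _ "Pow {..<n}"]) auto
  have finI: "finite I" "I \<subseteq> {..<n}" if "I \<in> ?J" for I
    using that finite_subset unfolding index_sets_def by auto
  have N0: "0 \<le> ?N i u" for i u by (simp add: n_norm_def)
  have Q0: "0 \<le> Q I u" for I u unfolding Q_def by (intro sum_nonneg N0)
  have Qq: "Q I u \<le> q u" if "I \<in> ?J" for I u
    unfolding q_def using that finJ Q0 by (intro member_le_sum) auto
  have q0: "0 \<le> q u" for u unfolding q_def by (intro sum_nonneg Q0)
  have len: "Suc (length (omit i ys)) = n" if "i < n" for i
    using that assms(3) by (simp add: length_omit)
  have NS: "?N i u = (S i u / fact n) powr (1 / p)" if "i < n" for i u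
    unfolding n_norm_def S_def using len[OF that] by simp
  have S0: "0 \<le> S i u" for i u unfolding S_def by (intro infsum_nonneg) auto
  have SN: "S i u = fact n * ?N i u powr p" if "i < n" for i u
    using S0[of i u] p by (simp add: NS[OF that] powr_powr)
  have Nq: "?N i u \<le> q u" if i: "i < n" for i u
  proof -
    \<comment> \<open>As \<open>1 \<le> m\<close>, the index \<open>i\<close> can be completed to an
      \<open>m\<close>-element set, and the class norm of that set dominates the \<open>i\<close>-th
      \<open>n\<close>-norm.\<close>
    have "m - 1 \<le> card ({..<n} - {i})" using assms(7) i by (simp add: diff_le_mono)
    then obtain I' where I': "I' \<subseteq> {..<n} - {i}" "card I' = m - 1"
      by (rule obtain_subset_with_card_n)
    then have "card (insert i I') = m"
      using assms(7) finite_subset[OF I'(1)] by (subst card_insert_disjoint) auto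
    then have I: "insert i I' \<in> ?J" using i I' unfolding index_sets_def by auto
    have "?N i u \<le> Q (insert i I') u"
      unfolding Q_def using finI[OF I] N0 by (intro member_le_sum) auto
    then show ?thesis using Qq[OF I] by (rule order_trans)
  qed
  obtain c where c: "0 \<le> c" "\<And>u. u \<in> ell p \<Longrightarrow> psum_le p UNIV u (c * (\<Sum>i<n. S i u))"
  proof -
    have "ys \<noteq> []" using assms(2,3) by auto
    from dominated_by_minors[OF p this assms(4-6)] show ?thesis
      using that unfolding dominated_def S_def assms(3) by blast
  qed
  \<comment> \<open>The factor \<open>n\<close> counts the summands \<open>S i u\<close>;
    \<open>fact n\<close> undoes the normalization of the \<open>n\<close>-norm.\<close>
  have lower: "psum_le p UNIV u (c * (real n * fact n) * q u powr p)" if "u \<in> ell p" for u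
  proof (rule psum_le_mono[OF c(2)[OF that]])
    have "(\<Sum>i<n. S i u) \<le> (\<Sum>i<n. fact n * q u powr p)"
      using p N0 Nq by (intro sum_mono) (simp add: SN powr_mono2)
    from mult_left_mono[OF this c(1)] show "c * (\<Sum>i<n. S i u) \<le> c * (real n * fact n) * q u powr p"
      by (simp add: mult_ac)
  qed
  have "\<exists>b\<ge>0. \<forall>u B. psum_le p UNIV u B \<longrightarrow> ?N i u \<le> b * B powr (1 / p)" if i: "i < n" for i
  proof -
    have "set (omit i ys) \<subseteq> ell p" by (rule order_trans[OF set_omit assms(5)])
    from dominated_minor[OF p this] obtain b where b: "0 \<le> b"
      "\<And>u. u \<in> ell p \<Longrightarrow>
        psum_le p {js. length js = n} (minor (u # omit i ys)) (b * (\<Sum>\<^sub>\<infinity>j. \<bar>u j\<bar> powr p))"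
      unfolding dominated_def len[OF i] by blast
    have "?N i u \<le> (b / fact n) powr (1 / p) * B powr (1 / p)" if B: "psum_le p UNIV u B" for u B
    proof -
      have "S i u \<le> b * (\<Sum>\<^sub>\<infinity>j. \<bar>u j\<bar> powr p)"
        unfolding S_def by (rule psum_le_infsum(2)[OF b(2)[OF psum_le_imp_ell[OF B]]])
      also have "\<dots> \<le> b * B" using psum_le_infsum(2)[OF B] b(1) by (rule mult_left_mono)
      finally have "?N i u \<le> (b / fact n * B) powr (1 / p)"
        unfolding NS[OF i] using p S0 by (intro powr_mono2) (auto simp: divide_right_mono)
      then show ?thesis using b(1) psum_le_nonneg[OF B] by (simp add: powr_mult[symmetric])
    qed
    then show ?thesis by (intro exI[of _ "(b / fact n) powr (1 / p)"]) auto
  qed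
  then obtain b where b: "\<And>i. i < n \<Longrightarrow> 0 \<le> b i"
    "\<And>i u B. i < n \<Longrightarrow> psum_le p UNIV u B \<Longrightarrow> ?N i u \<le> b i * B powr (1 / p)"
    by metis
  define c2 where "c2 = (\<Sum>I\<in>?J. \<Sum>i\<in>I. b i)"
  have "0 \<le> c2" unfolding c2_def using finI(2) b(1) by (intro sum_nonneg) blast
  have upper: "q u \<le> c2 * B powr (1 / p)" if "psum_le p UNIV u B" for u B
    unfolding q_def Q_def c2_def sum_distrib_right using finI(2) that by (intro sum_mono b(2)) auto
  obtain M where M: "\<And>x I. x \<in> K \<Longrightarrow> I \<in> ?J \<Longrightarrow> Q I x \<le> M"
    using assms(11) unfolding class_bounded_def Q assms(3) by blast
  obtain C where C: "0 < C" "C < 1"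
    "\<And>x y I. x \<in> K \<Longrightarrow> y \<in> K \<Longrightarrow> I \<in> ?J \<Longrightarrow> Q I (T x - T y) \<le> C * Q I (x - y)"
    using assms(13) unfolding class_contractive_def Q assms(3) by blast
  show ?thesis
  proof (rule ell_contraction_fixed_point[OF p assms(8,9) q0 _ lower \<open>0 \<le> c2\<close> upper _ _ assms(12) C(1,2)])
    show "0 \<le> c * (real n * fact n)" using c(1) by simp
    show "q x \<le> (\<Sum>I\<in>?J. M)" if "x \<in> K" for x
      unfolding q_def using M that by (intro sum_mono) auto
    show "q (T x - T y) \<le> C * q (x - y)" if "x \<in> K" "y \<in> K" for x y
      unfolding q_def sum_distrib_left using C(3) that by (intro sum_mono) auto
    \<comment> \<open>Each class norm is at most \<open>q\<close>, so one \<open>N\<close> serves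
      all index sets.\<close>
    show "l \<in> K" if x: "\<And>k. x k \<in> K" and l: "l \<in> ell p" and lim: "(\<lambda>k. q (x k - l)) \<longlonglongrightarrow> 0" for x l
    proof -
      have "class_tendsto p ys m x l"
        unfolding class_tendsto_def Q assms(3)
      proof (intro allI impI)
        fix \<epsilon> :: real assume "\<epsilon> > 0"
        then have "eventually (\<lambda>k. q (x k - l) < \<epsilon>) sequentially"
          using lim by (intro order_tendstoD)
        then show "\<exists>N. \<forall>k\<ge>N. \<forall>I\<in>?J. Q I (x k - l) < \<epsilon>"
          unfolding eventually_sequentially using Qq order_le_less_trans by blast
      qed
      then show ?thesis using assms(10) x l unfolding class_closed_def by blast
    qed
  qed
qed

end
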